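(* Let $r>0$, $\alpha>2$, let $\pmb\theta\in\mathbb{R}^n$ be fixed, and let $g_{\pmb\theta}:\mathbb{N}\times\mathbb{R}^+\to\mathbb{R}^+$. Assume that there are positive constants $c_1,c_2$ with $c_1+c_2<1$ such that $$|g_{\pmb\theta}(y,\lambda)-g_{\pmb\theta}(y^*,\lambda^* )|\le c_1|y-y^*|+c_2|\lambda-\lambda^*|$$ for all $y,y^*\in\mathbb{N}$, $\lambda,\lambda^*\in\mathbb{R}^+$, and $$\frac{(r+1)(\alpha-1)}{r(\alpha-2)}c_1^2+c_2^2+2c_1c_2<1.$$ Let $\{(y_t,\lambda_t)\}_{t\in\mathbb{Z}}$ be the unique strictly stationary and ergodic causal solution of $$y_t\mid\mathcal{F}_{t-1}\sim\mathcal{BNB}(\lambda_t,r,\alpha),\qquad \lambda_{t+1}=g_{\pmb\theta}(y_t,\lambda_t),\qquad t\in\mathbb{Z}.$$ Then $y_t$ has a finite second moment, $\mathbb{E}(y_t^2)<\infty$. Hence $\{y_t\}_{t\in\mathbb{Z}}$ is weakly stationary.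
   Context: $\mathbb{N}=\{0,1,2,\dots\}$, $\mathbb{R}^+=(0,\infty)$. For $\lambda>0$, $r>0$, $\alpha>1$, the beta negative binomial distribution $\mathcal{BNB}(\lambda,r,\alpha)$ is the distribution on $\mathbb{N}$ with probability mass function $$p(y|\lambda,r,\alpha)=\frac{\Gamma(y+r)}{\Gamma(y+1)\Gamma(r)}\,\frac{B(\alpha+r,(\alpha-1)\lambda/r+y)}{B(\alpha,(\alpha-1)\lambda/r)},$$ where $\Gamma$ is the gamma function and $B$ the beta function; its mean is $\lambda$. $\mathcal{F}_t$ is the $\sigma$-field generated by $\{y_t,y_{t-1},\dots\}$. The process is realized as $y_t=F^{-1}_{\lambda_t}(u_t)$, $\lambda_{t+1}=g_{\pmb\theta}(y_t,\lambda_t)$ with $\{u_t\}_{t\in\mathbb{Z}}$ i.i.d. uniform on $(0,1)$ and $F_\lambda^{-1}$ the quantile function of $\mathcal{BNB}(\lambda,r,\alpha)$; causal means $\lambda_t$ is a measurable function of $(u_{t-1},u_{t-2},\dots)$. The contraction condition with $c_1+c_2<1$ guarantees that a unique strictly stationary and ergodic causal solution exists, that it satisfies $\mathbb{E}(y_t)<\infty$, and that $\lambda_t$ is $\mathcal{F}_{t-1}$-measurable. *)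

theory Defs
  imports "HOL-Probability.Probability"
begin

definition bnb_mass :: "real \<Rightarrow> real \<Rightarrow> real \<Rightarrow> nat \<Rightarrow> real" where
  "bnb_mass lam r \<alpha> k =
     Gamma (real k + r) / (Gamma (real k + 1) * Gamma r)
       * (Beta (\<alpha> + r) ((\<alpha> - 1) * lam / r + real k) / Beta \<alpha> ((\<alpha> - 1) * lam / r))"

definition bnb_cdf :: "real \<Rightarrow> real \<Rightarrow> real \<Rightarrow> nat \<Rightarrow> real" where
  "bnb_cdf lam r \<alpha> k = (\<Sum>j\<le>k. bnb_mass lam r \<alpha> j)"

text \<open>Only meaningful for \<open>0 < p < 1\<close>; outside this range the set of admissible \<open>k\<close> may be
  empty.\<close>

definition bnb_quantile :: "real \<Rightarrow> real \<Rightarrow> real \<Rightarrow> real \<Rightarrow> nat" where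
  "bnb_quantile lam r \<alpha> p = (LEAST k. p \<le> bnb_cdf lam r \<alpha> k)"

definition path_law ::
    "'a measure \<Rightarrow> 'b measure \<Rightarrow> (int \<Rightarrow> 'a \<Rightarrow> 'b) \<Rightarrow> (int \<Rightarrow> 'b) measure" where
  "path_law M N X = distr M (Pi\<^sub>M UNIV (\<lambda>_. N)) (\<lambda>\<omega> t. X t \<omega>)"

text \<open>Laws on the product \<open>\<sigma>\<close>-algebra are determined by their finite-dimensional
  marginals, so this is the usual shift invariance of all finite-dimensional distributions.\<close>

definition strictly_stationary :: "'a measure \<Rightarrow> 'b measure \<Rightarrow> (int \<Rightarrow> 'a \<Rightarrow> 'b) \<Rightarrow> bool" where
  "strictly_stationary M N X \<longleftrightarrow>
     (\<forall>t. X t \<in> measurable M N) \<and>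
     (\<forall>h. path_law M N (\<lambda>t. X (t + h)) = path_law M N X)"

definition ergodic_process :: "'a measure \<Rightarrow> 'b measure \<Rightarrow> (int \<Rightarrow> 'a \<Rightarrow> 'b) \<Rightarrow> bool" where
  "ergodic_process M N X \<longleftrightarrow>
     (\<forall>A \<in> sets (Pi\<^sub>M UNIV (\<lambda>_. N)).
        (\<lambda>x t. x (t + 1)) -` A \<inter> space (Pi\<^sub>M UNIV (\<lambda>_. N)) = A \<longrightarrow>
        measure (path_law M N X) A \<in> {0, 1})"

definition weakly_stationary :: "'a measure \<Rightarrow> (int \<Rightarrow> 'a \<Rightarrow> real) \<Rightarrow> bool" where
  "weakly_stationary M X \<longleftrightarrow>
     (\<forall>t. X t \<in> borel_measurable M \<and> integrable M (\<lambda>\<omega>. (X t \<omega>)\<^sup>2)) \<and>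
     (\<forall>s t. integral\<^sup>L M (X s) = integral\<^sup>L M (X t)) \<and>
     (\<forall>s t h.
        integral\<^sup>L M (\<lambda>\<omega>. (X (s + h) \<omega> - integral\<^sup>L M (X (s + h))) * (X s \<omega> - integral\<^sup>L M (X s))) =
        integral\<^sup>L M (\<lambda>\<omega>. (X (t + h) \<omega> - integral\<^sup>L M (X (t + h))) * (X t \<omega> - integral\<^sup>L M (X t))))"

definition iid_uniform :: "'a measure \<Rightarrow> (int \<Rightarrow> 'a \<Rightarrow> real) \<Rightarrow> bool" where
  "iid_uniform M u \<longleftrightarrow>
     prob_space.indep_vars M (\<lambda>_. borel) u UNIV \<and>
     (\<forall>t. distr M borel (u t) = uniform_measure lborel {0<..<1})"

definition past_sigma :: "'a measure \<Rightarrow> (int \<Rightarrow> 'a \<Rightarrow> nat) \<Rightarrow> int \<Rightarrow> 'a measure" where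
  "past_sigma M y t = sigma (space M) {y s -` B \<inter> space M | s B. s \<le> t}"

text \<open>A law on the naturals, so the conditional law is given by the conditional probabilities of
  the singletons \<open>{k}\<close>.\<close>

definition bnb_model ::
    "'a measure \<Rightarrow> real \<Rightarrow> real \<Rightarrow> (nat \<times> real \<Rightarrow> real) \<Rightarrow>
     (int \<Rightarrow> 'a \<Rightarrow> nat) \<Rightarrow> (int \<Rightarrow> 'a \<Rightarrow> real) \<Rightarrow> bool" where
  "bnb_model M r \<alpha> g y lam \<longleftrightarrow>
     (\<forall>t. y t \<in> measurable M (count_space UNIV) \<and> lam t \<in> borel_measurable M) \<and>
     (\<forall>t. AE \<omega> in M. 0 < lam t \<omega>) \<and>
     (\<forall>t k. AE \<omega> in M.
        real_cond_exp M (past_sigma M y (t - 1)) (indicator {\<omega> \<in> space M. y t \<omega> = k}) \<omega>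
          = bnb_mass (lam t \<omega>) r \<alpha> k) \<and>
     (\<forall>t. AE \<omega> in M. lam (t + 1) \<omega> = g (y t \<omega>, lam t \<omega>))"

definition bnb_realization ::
    "'a measure \<Rightarrow> real \<Rightarrow> real \<Rightarrow> (int \<Rightarrow> 'a \<Rightarrow> real) \<Rightarrow>
     (int \<Rightarrow> 'a \<Rightarrow> nat) \<Rightarrow> (int \<Rightarrow> 'a \<Rightarrow> real) \<Rightarrow> bool" where
  "bnb_realization M r \<alpha> u y lam \<longleftrightarrow>
     (\<forall>t. AE \<omega> in M. y t \<omega> = bnb_quantile (lam t \<omega>) r \<alpha> (u t \<omega>))"

definition causal :: "'a measure \<Rightarrow> (int \<Rightarrow> 'a \<Rightarrow> real) \<Rightarrow> (int \<Rightarrow> 'a \<Rightarrow> real) \<Rightarrow> bool" where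
  "causal M u lam \<longleftrightarrow>
     (\<forall>t. \<exists>f \<in> borel_measurable (Pi\<^sub>M (UNIV :: nat set) (\<lambda>_. borel)).
        AE \<omega> in M. lam t \<omega> = f (\<lambda>k. u (t - 1 - int k) \<omega>))"

end

theory Submission
  imports Defs
begin

text \<open>The heart of the matter is a drift inequality for \<open>V(\<lambda>) = \<lambda>\<^sup>2\<close>. The contraction
  condition bounds \<open>g\<close> by an affine function, \<open>g(y, \<lambda>) \<le> d + c1 y + c2 \<lambda>\<close>, and the law
  \<open>BNB(\<lambda>, r, \<alpha>)\<close> has mean \<open>\<lambda>\<close> and second moment \<open>\<kappa> \<lambda>\<^sup>2 + D \<lambda>\<close> with
  \<open>\<kappa> = (r + 1)(\<alpha> - 1) / (r (\<alpha> - 2))\<close>. Squaring the affine bound and averaging over \<open>y\<close>, the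
  intensity \<open>\<lambda>'\<close> that follows \<open>\<lambda>\<close> satisfies
  \<open>E(\<lambda>'\<^sup>2 | \<lambda>) \<le> (\<kappa> c1\<^sup>2 + c2\<^sup>2 + 2 c1 c2) \<lambda>\<^sup>2 + K \<lambda> + d\<^sup>2\<close>. The leading coefficient is the one
  assumed to be below 1, and the linear term can be absorbed, so
  \<open>E(\<lambda>'\<^sup>2 | \<lambda>) \<le> \<rho> \<lambda>\<^sup>2 + C\<close> with \<open>\<rho> < 1\<close>. If \<open>E \<lambda>\<^sup>2\<close> were known to be finite, stationarity
  would at once give \<open>E \<lambda>\<^sup>2 \<le> C / (1 - \<rho>)\<close>. To obtain finiteness as well, the same
  comparison is made for the truncations \<open>min(\<lambda>\<^sup>2, N)\<close>, whose expectations are finite, and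
  \<open>N\<close> tends to infinity (\<open>stationary_drift_bound\<close>). Then
  \<open>E y\<^sup>2 = E(\<kappa> \<lambda>\<^sup>2 + D \<lambda>)\<close> is finite, and weak stationarity is inherited from the shift
  invariance of the path law.

  The moments of the beta negative binomial law come from its representation as a mixture of
  negative binomial laws: integrating the negative binomial series against a beta density
  gives \<open>Beta_mixture_sums\<close>, and multiplying by \<open>y\<close> shifts the parameters of this series.

  The model prescribes the law of \<open>y\<close> given the past counts, whereas the drift inequality
  averages a function of the pair \<open>(y, \<lambda>)\<close>. The two match because \<open>\<lambda>\<close> is
  almost surely a function of the past counts: it is the mean of its own conditional law, that
  is, the sum of \<open>k P(y = k | past)\<close> (\<open>bnb_intensity_AE_eq_past_measurable\<close>).\<close>

section \<open>Moments of the beta negative binomial distribution\<close>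

lemma neg_binomial_series:
  fixes r x :: real
  assumes "0 < x" "x < 1"
  shows "(\<lambda>k. pochhammer r k / fact k * (1 - x) ^ k) sums x powr (- r)"
proof -
  have "(\<lambda>k. ((- r) gchoose k) * (x - 1) ^ k) sums (1 + (x - 1)) powr (- r)"
    using assms by (intro gen_binomial_real) auto
  moreover have "((- r) gchoose k) * (x - 1) ^ k = pochhammer r k / fact k * (1 - x) ^ k" for k
  proof -
    have "(x - 1) ^ k = (-1) ^ k * (1 - x) ^ k"
      by (metis minus_diff_eq mult_minus1 power_mult_distrib)
    then show ?thesis
      by (simp add: gbinomial_pochhammer power_mult_distrib[symmetric])
  qed
  ultimately show ?thesis by simp
qed

lemma Beta_real_pos:
  fixes a b :: real
  assumes "0 < a" "0 < b"
  shows "0 < Beta a b"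
  using assms by (simp add: Beta_def Gamma_real_pos)

lemma pos_not_nonpos_Ints:
  fixes x :: real
  assumes "0 < x"
  shows "x \<notin> \<int>\<^sub>\<le>\<^sub>0"
  using assms by (auto elim!: nonpos_Ints_cases)

lemma nn_integral_Beta:
  fixes a b :: real
  assumes "0 < a" "0 < b"
  shows "(\<integral>\<^sup>+x. ennreal (x powr (a - 1) * (1 - x) powr (b - 1)) * indicator {0<..<1} x \<partial>lborel)
    = ennreal (Beta a b)"
  using has_integral_Beta_real[OF assms]
  by (intro nn_integral_has_integral_lebesgue') (auto simp: has_integral_Icc_iff_Ioo)

text \<open>The negative binomial weights with success probability \<open>x\<close>, integrated over \<open>x\<close> against the
  unnormalized beta density; since those weights sum to 1 for every \<open>x\<close>, only the density
  remains. All terms are nonnegative, so sum and integral commute.\<close>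

lemma Beta_mixture_sums:
  fixes a b r :: real
  assumes "0 < a" "0 < b" "0 < r"
  shows "(\<lambda>k. pochhammer r k / fact k * Beta (a + r) (b + real k)) sums Beta a b"
proof -
  define w where "w k = pochhammer r k / fact k" for k :: nat
  have w: "0 \<le> w k" for k
    using assms by (simp add: w_def pochhammer_nonneg)
  have nonneg: "0 \<le> w k * Beta (a + r) (b + real k)" for k
    using assms w by (intro mult_nonneg_nonneg less_imp_le[OF Beta_real_pos]) auto
  let ?f = "\<lambda>k x. ennreal (w k) * (ennreal (x powr (a + r - 1) * (1 - x) powr (b + real k - 1)) * indicator {0<..<1} x)"
  have "(\<Sum>k. ennreal (w k * Beta (a + r) (b + real k))) = (\<Sum>k. \<integral>\<^sup>+x. ?f k x \<partial>lborel)"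
    using assms w Beta_real_pos[of "a + r"]
    by (subst nn_integral_cmult) (auto simp: nn_integral_Beta ennreal_mult'[of "w _"] simp del: ennreal_mult' ennreal_mult'')
  also have "\<dots> = (\<integral>\<^sup>+x. (\<Sum>k. ?f k x) \<partial>lborel)"
    by (rule nn_integral_suminf[symmetric]) measurable
  also have "\<dots> = (\<integral>\<^sup>+x. ennreal (x powr (a - 1) * (1 - x) powr (b - 1)) * indicator {0<..<1} x \<partial>lborel)"
  proof (rule nn_integral_cong)
    fix x :: real
    show "(\<Sum>k. ?f k x) = ennreal (x powr (a - 1) * (1 - x) powr (b - 1)) * indicator {0<..<1} x"
    proof (cases "0 < x \<and> x < 1")
      case True
      let ?c = "x powr (a + r - 1) * (1 - x) powr (b - 1)"
      have "(\<lambda>k. ?c * (w k * (1 - x) ^ k)) sums (?c * x powr (- r))"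
        unfolding w_def using neg_binomial_series[of x r] True by (intro sums_mult) auto
      moreover have "?c * (w k * (1 - x) ^ k)
          = w k * (x powr (a + r - 1) * (1 - x) powr (b + real k - 1))" for k
        using True powr_add[of "1 - x" "b - 1" "real k"]
        by (simp add: powr_realpow algebra_simps)
      moreover have "?c * x powr (- r) = x powr (a - 1) * (1 - x) powr (b - 1)"
        using True powr_add[of x "a + r - 1" "- r"] by simp
      ultimately have "(\<lambda>k. w k * (x powr (a + r - 1) * (1 - x) powr (b + real k - 1)))
          sums (x powr (a - 1) * (1 - x) powr (b - 1))"
        by simp
      then have "(\<lambda>k. ennreal (w k * (x powr (a + r - 1) * (1 - x) powr (b + real k - 1))))
          sums ennreal (x powr (a - 1) * (1 - x) powr (b - 1))"
        using w by (subst sums_ennreal) auto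
      then show ?thesis
        using True w by (simp add: sums_iff ennreal_mult)
    next
      case False
      then have "x \<notin> {0<..<1}" by simp
      then show ?thesis by simp
    qed
  qed
  also have "\<dots> = ennreal (Beta a b)"
    using assms by (intro nn_integral_Beta)
  finally have "(\<lambda>k. ennreal (w k * Beta (a + r) (b + real k))) sums ennreal (Beta a b)"
    by (simp add: sums_iff)
  then show ?thesis
    using nonneg Beta_real_pos[of a b] assms by (subst (asm) sums_ennreal) (auto simp: w_def)
qed

text \<open>The identity \<open>k (r)\<^sub>k / k! = r (r + 1)\<^bsub>k-1\<^esub> / (k - 1)!\<close> trades a factor \<open>k\<close> for the
  parameters \<open>(a - 1, b + 1, r + 1)\<close>, the sum \<open>a + r\<close> being preserved. Each use raises the order
  of the factorial moment by one.\<close>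

lemma Beta_mixture_weighted_sums_Suc:
  fixes a b r :: real and h :: "nat \<Rightarrow> real"
  assumes "(\<lambda>k. h k * (pochhammer (r + 1) k / fact k * Beta ((a - 1) + (r + 1)) ((b + 1) + real k))) sums s"
  shows "(\<lambda>k. real k * h (k - 1) * (pochhammer r k / fact k * Beta (a + r) (b + real k))) sums (r * s)"
proof -
  let ?f = "\<lambda>k. real k * h (k - 1) * (pochhammer r k / fact k * Beta (a + r) (b + real k))"
  have "?f (Suc k) = r * (h k * (pochhammer (r + 1) k / fact k * Beta ((a - 1) + (r + 1)) ((b + 1) + real k)))" for k
  proof -
    have "real (Suc k) * (pochhammer r (Suc k) / fact (Suc k)) = r * (pochhammer (r + 1) k / fact k)"
      by (simp add: pochhammer_rec del: of_nat_Suc)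
    moreover have "Beta (a + r) (b + real (Suc k)) = Beta ((a - 1) + (r + 1)) ((b + 1) + real k)"
      by (simp add: algebra_simps)
    ultimately show ?thesis
      by (metis (no_types, opaque_lifting) diff_Suc_1 mult.assoc mult.left_commute)
  qed
  then have "(\<lambda>k. ?f (Suc k)) sums (r * s)"
    using sums_mult[OF assms, of r] by (simp only:)
  then show ?thesis
    using sums_Suc_iff[of ?f "r * s"] by simp
qed

lemma Beta_mixture_mean_sums:
  fixes a b r :: real
  assumes "1 < a" "0 < b" "0 < r"
  shows "(\<lambda>k. real k * (pochhammer r k / fact k * Beta (a + r) (b + real k)))
    sums (r * Beta (a - 1) (b + 1))"
  using Beta_mixture_weighted_sums_Suc[of "\<lambda>_. 1" r a b]
    Beta_mixture_sums[of "a - 1" "b + 1" "r + 1"] assms by simp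

lemma Beta_mixture_second_factorial_moment_sums:
  fixes a b r :: real
  assumes "2 < a" "0 < b" "0 < r"
  shows "(\<lambda>k. (real k * (real k - 1)) * (pochhammer r k / fact k * Beta (a + r) (b + real k)))
    sums (r * (r + 1) * Beta (a - 2) (b + 2))"
proof -
  have "real k * real (k - 1) = real k * (real k - 1)" for k
    by (cases k) auto
  moreover have "(\<lambda>k. real k * real (k - 1) * (pochhammer r k / fact k * Beta (a + r) (b + real k)))
      sums (r * ((r + 1) * Beta (a - 1 - 1) (b + 1 + 1)))"
    using assms by (intro Beta_mixture_weighted_sums_Suc Beta_mixture_mean_sums) auto
  moreover have "a - 1 - 1 = a - 2" "b + 1 + 1 = b + 2"
    by simp_all
  ultimately show ?thesis
    by (simp only: mult.assoc)
qed

text \<open>In this form the mass function is a term of the beta mixture series, normalized by its sum.\<close>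

lemma bnb_mass_eq:
  assumes "0 < r"
  shows "bnb_mass l r \<alpha> k = (pochhammer r k / fact k * Beta (\<alpha> + r) ((\<alpha> - 1) * l / r + real k))
    / Beta \<alpha> ((\<alpha> - 1) * l / r)"
proof -
  have "Gamma (real k + r) = pochhammer r k * Gamma r"
    using pochhammer_Gamma[OF pos_not_nonpos_Ints[OF assms], of k] Gamma_real_pos[OF assms]
    by (simp add: add.commute)
  moreover have "Gamma (real k + 1) = fact k"
    by (metis Gamma_fact add.commute)
  ultimately show ?thesis
    using Gamma_real_pos[OF assms] by (simp add: bnb_mass_def)
qed

lemma bnb_mass_nonneg:
  assumes "0 < r" "1 < \<alpha>" "0 < l"
  shows "0 \<le> bnb_mass l r \<alpha> k"
  using assms by (auto simp: bnb_mass_eq intro!: divide_nonneg_nonneg mult_nonneg_nonneg pochhammer_nonneg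
      less_imp_le[OF Beta_real_pos] add_pos_nonneg)

lemma bnb_mass_sums:
  assumes "0 < r" "1 < \<alpha>" "0 < l"
  shows "(\<lambda>k. bnb_mass l r \<alpha> k) sums 1"
proof -
  have b: "0 < (\<alpha> - 1) * l / r" using assms by simp
  show ?thesis
    using sums_divide[OF Beta_mixture_sums[of \<alpha> "(\<alpha> - 1) * l / r" r], of "Beta \<alpha> ((\<alpha> - 1) * l / r)"]
      assms b Beta_real_pos[of \<alpha> "(\<alpha> - 1) * l / r"]
    by (simp add: bnb_mass_eq)
qed

lemma Beta_shift:
  fixes a b :: real
  assumes "1 < a" "0 < b"
  shows "Beta (a - 1) (b + 1) = b / (a - 1) * Beta a b"
proof -
  have "(a - 1 + b) * Beta a b = (a - 1) * Beta (a - 1) b"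
    using Beta_plus1_left[OF pos_not_nonpos_Ints, of "a - 1" b] assms by simp
  moreover have "(a - 1 + b) * Beta (a - 1) (b + 1) = b * Beta (a - 1) b"
    using Beta_plus1_right[OF pos_not_nonpos_Ints, of b "a - 1"] assms by simp
  ultimately have "(a - 1 + b) * ((a - 1) * Beta (a - 1) (b + 1)) = (a - 1 + b) * (b * Beta a b)"
    by (simp add: mult.left_commute)
  then have "(a - 1) * Beta (a - 1) (b + 1) = b * Beta a b"
    using assms by (subst (asm) mult_left_cancel) auto
  then show ?thesis using assms by (simp add: field_simps)
qed

lemma bnb_mean_sums:
  assumes "0 < r" "1 < \<alpha>" "0 < l"
  shows "(\<lambda>k. real k * bnb_mass l r \<alpha> k) sums l"
proof -
  define b where "b = (\<alpha> - 1) * l / r"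
  have b: "0 < b" using assms by (simp add: b_def)
  have "(\<lambda>k. real k * bnb_mass l r \<alpha> k) sums (r * Beta (\<alpha> - 1) (b + 1) / Beta \<alpha> b)"
    using sums_divide[OF Beta_mixture_mean_sums[of \<alpha> b r], of "Beta \<alpha> b"] assms b
    by (simp add: bnb_mass_eq b_def)
  also have "r * Beta (\<alpha> - 1) (b + 1) / Beta \<alpha> b = r * b / (\<alpha> - 1)"
    using assms b Beta_shift[of \<alpha> b] Beta_real_pos[of \<alpha> b] by simp
  also have "\<dots> = l" using assms by (simp add: b_def)
  finally show ?thesis .
qed

text \<open>The second moment exceeds the second factorial moment by the mean. The coefficient
  of \<open>l\<^sup>2\<close> is the constant of the moment condition.\<close>

lemma bnb_second_moment_sums:
  assumes "0 < r" "2 < \<alpha>" "0 < l"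
  shows "(\<lambda>k. (real k)\<^sup>2 * bnb_mass l r \<alpha> k)
    sums ((r + 1) * (\<alpha> - 1) / (r * (\<alpha> - 2)) * l\<^sup>2 + ((r + 1) / (\<alpha> - 2) + 1) * l)"
proof -
  define b where "b = (\<alpha> - 1) * l / r"
  have b: "0 < b" using assms by (simp add: b_def)
  have "(\<lambda>k. real k * (real k - 1) * bnb_mass l r \<alpha> k)
      sums (r * (r + 1) * Beta (\<alpha> - 2) (b + 2) / Beta \<alpha> b)"
    using sums_divide[OF Beta_mixture_second_factorial_moment_sums[of \<alpha> b r], of "Beta \<alpha> b"] assms b
    by (simp add: bnb_mass_eq b_def)
  also have "Beta (\<alpha> - 2) (b + 2) = (b + 1) / (\<alpha> - 2) * (b / (\<alpha> - 1) * Beta \<alpha> b)"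
    using Beta_shift[of "\<alpha> - 1" "b + 1"] Beta_shift[of \<alpha> b] assms b by (simp add: add.assoc)
  also have "r * (r + 1) * ((b + 1) / (\<alpha> - 2) * (b / (\<alpha> - 1) * Beta \<alpha> b)) / Beta \<alpha> b
      = r * (r + 1) * (b + 1) / (\<alpha> - 2) * (b / (\<alpha> - 1))"
    using assms b Beta_real_pos[of \<alpha> b] by simp
  also have "b / (\<alpha> - 1) = l / r" using assms by (simp add: b_def)
  finally have "(\<lambda>k. real k * (real k - 1) * bnb_mass l r \<alpha> k + real k * bnb_mass l r \<alpha> k)
      sums (r * (r + 1) * (b + 1) / (\<alpha> - 2) * (l / r) + l)"
    using assms by (intro sums_add bnb_mean_sums) auto
  moreover have "r * (r + 1) * (b + 1) / (\<alpha> - 2) * (l / r) + l =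
      (r + 1) * (\<alpha> - 1) / (r * (\<alpha> - 2)) * l\<^sup>2 + ((r + 1) / (\<alpha> - 2) + 1) * l"
  proof -
    have "r * (r + 1) * (b + 1) / (\<alpha> - 2) * (l / r) = (r + 1) * b * l / (\<alpha> - 2) + (r + 1) * l / (\<alpha> - 2)"
      using assms by (simp add: algebra_simps add_divide_distrib)
    also have "(r + 1) * b * l / (\<alpha> - 2) = (r + 1) * (\<alpha> - 1) / (r * (\<alpha> - 2)) * l\<^sup>2"
      by (simp add: b_def power2_eq_square)
    finally show ?thesis by (simp add: algebra_simps)
  qed
  ultimately show ?thesis
    by (simp add: algebra_simps power2_eq_square)
qed

text \<open>For use with \<open>d + c1 y + c2 l\<close> as a bound on the intensity following \<open>l\<close>: in the variable \<open>l\<close>,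
  the leading coefficient is the left-hand side of the moment condition.\<close>

lemma bnb_affine_square_sums:
  fixes d c1 c2 :: real
  assumes "0 < r" "2 < \<alpha>" "0 < l"
  shows "(\<lambda>k. (d + c1 * real k + c2 * l)\<^sup>2 * bnb_mass l r \<alpha> k) sums
    (((r + 1) * (\<alpha> - 1) / (r * (\<alpha> - 2)) * c1\<^sup>2 + c2\<^sup>2 + 2 * c1 * c2) * l\<^sup>2
      + (c1\<^sup>2 * ((r + 1) / (\<alpha> - 2) + 1) + 2 * d * (c1 + c2)) * l + d\<^sup>2)"
proof -
  have "(\<lambda>k. (d + c2 * l)\<^sup>2 * bnb_mass l r \<alpha> k + (2 * c1 * (d + c2 * l)) * (real k * bnb_mass l r \<alpha> k)
        + c1\<^sup>2 * ((real k)\<^sup>2 * bnb_mass l r \<alpha> k)) sums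
      ((d + c2 * l)\<^sup>2 * 1 + (2 * c1 * (d + c2 * l)) * l + c1\<^sup>2 *
        ((r + 1) * (\<alpha> - 1) / (r * (\<alpha> - 2)) * l\<^sup>2 + ((r + 1) / (\<alpha> - 2) + 1) * l))"
    using assms by (intro sums_add sums_mult bnb_mass_sums bnb_mean_sums bnb_second_moment_sums) auto
  then show ?thesis
    by (simp add: power2_eq_square algebra_simps)
qed

section \<open>Integrals under a conditional law\<close>

text \<open>The defining property of the conditional expectation for weights that may be unbounded, or even
  infinite: \<open>f\<close> is nonnegative and integrable, so its real and its extended nonnegative conditional
  expectations agree almost everywhere.\<close>

lemma (in finite_measure_subalgebra) nn_integral_mult_real_cond_exp:
  assumes [measurable]: "\<phi> \<in> borel_measurable F" "integrable M f" and f: "\<And>x. 0 \<le> f x"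
  shows "(\<integral>\<^sup>+x. \<phi> x * ennreal (f x) \<partial>M) = (\<integral>\<^sup>+x. \<phi> x * ennreal (real_cond_exp M F f x) \<partial>M)"
proof -
  have [measurable]: "f \<in> borel_measurable M" using assms by auto
  have "(\<integral>\<^sup>+x. 1 * nn_cond_exp M F (\<lambda>x. ennreal (f x)) x \<partial>M) = (\<integral>\<^sup>+x. 1 * ennreal (f x) \<partial>M)"
    by (rule nn_cond_exp_intg) auto
  also have "\<dots> \<noteq> \<infinity>"
    using assms by (simp add: nn_integral_eq_integral)
  finally have "AE x in M. nn_cond_exp M F (\<lambda>x. ennreal (f x)) x \<noteq> \<infinity>"
    by (intro nn_integral_noteq_infinite) auto
  moreover have "AE x in M. (0::ennreal) = nn_cond_exp M F (\<lambda>x. 0) x"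
    using nn_cond_exp_F_meas[of "\<lambda>x. 0"] by auto
  ultimately have "AE x in M. nn_cond_exp M F (\<lambda>x. ennreal (f x)) x = ennreal (real_cond_exp M F f x)"
  proof eventually_elim
    case (elim x)
    have "(\<lambda>x. ennreal (- f x)) = (\<lambda>x. 0)"
      using f by (intro ext ennreal_neg) simp
    with elim show ?case
      by (simp add: real_cond_exp_def less_top)
  qed
  then have "(\<integral>\<^sup>+x. \<phi> x * ennreal (real_cond_exp M F f x) \<partial>M)
      = (\<integral>\<^sup>+x. \<phi> x * nn_cond_exp M F (\<lambda>x. ennreal (f x)) x \<partial>M)"
    by (intro nn_integral_cong_AE) auto
  also have "\<dots> = (\<integral>\<^sup>+x. \<phi> x * ennreal (f x) \<partial>M)"
    by (rule nn_cond_exp_intg) auto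
  finally show ?thesis by simp
qed

text \<open>Because \<open>L\<close> is \<open>F\<close>-measurable, it acts as a constant when \<open>Y\<close> is averaged out given \<open>F\<close>.\<close>

lemma (in finite_measure_subalgebra) nn_integral_conditional_law:
  fixes Y :: "'a \<Rightarrow> nat" and L :: "'a \<Rightarrow> real" and \<phi> :: "nat \<Rightarrow> real \<Rightarrow> ennreal"
  assumes Y [measurable]: "Y \<in> measurable M (count_space UNIV)"
    and L [measurable]: "L \<in> borel_measurable F"
    and \<phi> [measurable]: "\<And>k. \<phi> k \<in> borel_measurable borel"
    and p: "\<And>k. AE x in M. real_cond_exp M F (indicator {x \<in> space M. Y x = k}) x = p x k"
  shows "(\<integral>\<^sup>+x. \<phi> (Y x) (L x) \<partial>M) = (\<integral>\<^sup>+x. (\<Sum>k. \<phi> k (L x) * ennreal (p x k)) \<partial>M)"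
proof -
  let ?I = "\<lambda>k. indicator {x \<in> space M. Y x = k} :: 'a \<Rightarrow> real"
  have LM [measurable]: "L \<in> borel_measurable M"
    using measurable_from_subalg[OF subalg L] .
  have "\<phi> (Y x) (L x) = (\<Sum>k. \<phi> k (L x) * ennreal (?I k x))" if "x \<in> space M" for x
  proof -
    have "(\<Sum>k. \<phi> k (L x) * ennreal (?I k x)) = (\<Sum>k\<in>{Y x}. \<phi> k (L x) * ennreal (?I k x))"
      by (rule suminf_finite) auto
    with that show ?thesis by simp
  qed
  then have "(\<integral>\<^sup>+x. \<phi> (Y x) (L x) \<partial>M) = (\<integral>\<^sup>+x. (\<Sum>k. \<phi> k (L x) * ennreal (?I k x)) \<partial>M)"
    by (intro nn_integral_cong) auto
  also have "\<dots> = (\<Sum>k. \<integral>\<^sup>+x. \<phi> k (L x) * ennreal (?I k x) \<partial>M)"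
    by (rule nn_integral_suminf) measurable
  also have "\<dots> = (\<Sum>k. \<integral>\<^sup>+x. \<phi> k (L x) * ennreal (real_cond_exp M F (?I k) x) \<partial>M)"
  proof (rule suminf_cong, rule nn_integral_mult_real_cond_exp)
    show "integrable M (?I k)" for k
      by (rule integrable_real_indicator) (auto simp: less_top[symmetric])
  qed auto
  also have "\<dots> = (\<integral>\<^sup>+x. (\<Sum>k. \<phi> k (L x) * ennreal (real_cond_exp M F (?I k) x)) \<partial>M)"
    by (rule nn_integral_suminf[symmetric]) measurable
  also have "\<dots> = (\<integral>\<^sup>+x. (\<Sum>k. \<phi> k (L x) * ennreal (p x k)) \<partial>M)"
  proof (rule nn_integral_cong_AE)
    have "AE x in M. \<forall>k. real_cond_exp M F (?I k) x = p x k"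
      using p by (simp add: AE_all_countable)
    then show "AE x in M. (\<Sum>k. \<phi> k (L x) * ennreal (real_cond_exp M F (?I k) x))
        = (\<Sum>k. \<phi> k (L x) * ennreal (p x k))"
      by eventually_elim simp
  qed
  finally show ?thesis .
qed

section \<open>Drift inequalities and strict stationarity\<close>

text \<open>Here \<open>X\<close> and \<open>Y\<close> play the role of a Lyapunov function at two consecutive times. Equality
  in law gives \<open>E min(X, N) \<le> E min(\<rho> X + C, N)\<close>, where both sides are finite. Pointwise, the
  difference of the two truncations is at least \<open>(1 - \<rho>) X - C\<close> as long as \<open>X \<le> N\<close>, and it is
  nonnegative beyond that. Hence \<open>(1 - \<rho>) E(X; X \<le> N) \<le> C\<close>, uniformly in \<open>N\<close>; letting
  \<open>N\<close> grow yields the finiteness of \<open>E X\<close> together with the bound.\<close>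

lemma (in prob_space) stationary_drift_bound:
  fixes X Y :: "'a \<Rightarrow> real"
  assumes [measurable]: "X \<in> borel_measurable M" "Y \<in> borel_measurable M"
    and law: "distr M borel Y = distr M borel X"
    and X: "\<And>x. 0 \<le> X x"
    and \<rho>: "0 \<le> \<rho>" "\<rho> < 1" and C: "0 \<le> C"
    and drift: "\<And>N. 0 \<le> N \<Longrightarrow>
      (\<integral>\<^sup>+x. ennreal (min (Y x) N) \<partial>M) \<le> (\<integral>\<^sup>+x. ennreal (min (\<rho> * X x + C) N) \<partial>M)"
  shows "(\<integral>\<^sup>+x. ennreal (X x) \<partial>M) \<le> ennreal (C / (1 - \<rho>))"
proof -
  have trunc: "(\<integral>\<^sup>+x. ennreal (X x * indicator {..N} (X x)) \<partial>M) \<le> ennreal (C / (1 - \<rho>))"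
    if N0: "0 \<le> N" for N
  proof -
    have bdd: "integrable M h" if "h \<in> borel_measurable M" "\<And>x. 0 \<le> h x" "\<And>x. h x \<le> N" for h
      using that by (intro integrable_const_bound[of _ N]) auto
    have i1: "integrable M (\<lambda>x. min (X x) N)" using N0 X by (intro bdd) auto
    have i2: "integrable M (\<lambda>x. min (\<rho> * X x + C) N)" using N0 X \<rho> C by (intro bdd) auto
    have i3: "integrable M (\<lambda>x. X x * indicator {..N} (X x))"
      using N0 X by (intro bdd) (auto simp: indicator_def)
    have "(\<integral>\<^sup>+x. ennreal (min (X x) N) \<partial>M) = (\<integral>\<^sup>+x. ennreal (min x N) \<partial>distr M borel X)"
      by (simp add: nn_integral_distr)
    also have "\<dots> = (\<integral>\<^sup>+x. ennreal (min (Y x) N) \<partial>M)"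
      by (simp add: law[symmetric] nn_integral_distr)
    also have "\<dots> \<le> (\<integral>\<^sup>+x. ennreal (min (\<rho> * X x + C) N) \<partial>M)"
      by (rule drift[OF N0])
    finally have le: "expectation (\<lambda>x. min (X x) N) \<le> expectation (\<lambda>x. min (\<rho> * X x + C) N)"
      using i1 i2 N0 X \<rho> C by (simp add: nn_integral_eq_integral)
    have "expectation (\<lambda>x. (1 - \<rho>) * (X x * indicator {..N} (X x)) - C)
        \<le> expectation (\<lambda>x. min (X x) N - min (\<rho> * X x + C) N)"
    proof (rule integral_mono)
      fix x
      show "(1 - \<rho>) * (X x * indicator {..N} (X x)) - C \<le> min (X x) N - min (\<rho> * X x + C) N"
      proof (cases "X x \<le> N")
        case True
        then have "(1 - \<rho>) * (X x * indicator {..N} (X x)) - C = min (X x) N - (\<rho> * X x + C)"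
          by (simp add: algebra_simps)
        also have "\<dots> \<le> min (X x) N - min (\<rho> * X x + C) N"
          by simp
        finally show ?thesis .
      next
        case False
        then show ?thesis using C by simp
      qed
    qed (use i1 i2 i3 in auto)
    then have "(1 - \<rho>) * expectation (\<lambda>x. X x * indicator {..N} (X x)) \<le> C"
      using le i1 i2 i3 by (simp add: prob_space)
    then have "expectation (\<lambda>x. X x * indicator {..N} (X x)) \<le> C / (1 - \<rho>)"
      using \<rho> by (simp add: field_simps)
    then show ?thesis
      using i3 X C \<rho> by (subst nn_integral_eq_integral) (auto intro!: ennreal_leI)
  qed
  let ?f = "\<lambda>n x. ennreal (X x * indicator {..real n} (X x))"
  have "(\<integral>\<^sup>+x. ennreal (X x) \<partial>M) = (\<integral>\<^sup>+x. (SUP n. ?f n x) \<partial>M)"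
  proof (rule nn_integral_cong)
    fix x
    show "ennreal (X x) = (SUP n. ?f n x)"
    proof (rule antisym)
      obtain n where "X x \<le> real n" using real_arch_simple by blast
      then have "ennreal (X x) = ?f n x" by simp
      also have "\<dots> \<le> (SUP n. ?f n x)" by (rule SUP_upper) simp
      finally show "ennreal (X x) \<le> (SUP n. ?f n x)" .
      show "(SUP n. ?f n x) \<le> ennreal (X x)"
        by (rule SUP_least) (auto simp: indicator_def)
    qed
  qed
  also have "\<dots> = (SUP n. \<integral>\<^sup>+x. ?f n x \<partial>M)"
    by (rule nn_integral_monotone_convergence_SUP)
      (auto simp: incseq_def le_fun_def indicator_def intro!: ennreal_leI X)
  also have "\<dots> \<le> ennreal (C / (1 - \<rho>))"
    by (rule SUP_least, rule trunc) simp
  finally show ?thesis .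
qed

lemma strictly_stationary_functional:
  assumes stat: "strictly_stationary M N X"
    and [measurable]: "\<Phi> \<in> measurable (Pi\<^sub>M UNIV (\<lambda>_. N)) K"
  shows "distr M K (\<lambda>\<omega>. \<Phi> (\<lambda>t. X (t + h) \<omega>)) = distr M K (\<lambda>\<omega>. \<Phi> (\<lambda>t. X t \<omega>))"
proof -
  have [measurable]: "X t \<in> measurable M N" for t
    using stat by (simp add: strictly_stationary_def)
  have [measurable]: "(\<lambda>\<omega> t. X (t + c) \<omega>) \<in> measurable M (Pi\<^sub>M UNIV (\<lambda>_. N))" for c
    by (rule measurable_PiM_single') (auto simp: PiE_def extensional_def measurable_space[of "X _" M N])
  have *: "distr M K (\<lambda>\<omega>. \<Phi> (\<lambda>t. X (t + c) \<omega>)) = distr (path_law M N (\<lambda>t. X (t + c))) K \<Phi>" for c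
    unfolding path_law_def by (subst distr_distr) (auto simp: comp_def)
  show ?thesis
    using stat *[of h] *[of 0] by (simp add: strictly_stationary_def)
qed

text \<open>Means and covariances are integrals of functionals of the whole path, so they are determined
  by the path law, and shift invariance of the law makes them independent of time.\<close>

lemma strictly_stationary_imp_weakly_stationary:
  fixes f :: "'b \<Rightarrow> real"
  assumes stat: "strictly_stationary M N Z"
    and f [measurable]: "f \<in> borel_measurable N"
    and sq: "\<And>t. integrable M (\<lambda>\<omega>. (f (Z t \<omega>))\<^sup>2)"
  shows "weakly_stationary M (\<lambda>t \<omega>. f (Z t \<omega>))"
proof -
  have Z [measurable]: "Z t \<in> measurable M N" for t
    using stat by (simp add: strictly_stationary_def)
  have shift: "(\<integral>\<omega>. \<Phi> (\<lambda>t. Z (t + h) \<omega>) \<partial>M) = (\<integral>\<omega>. \<Phi> (\<lambda>t. Z t \<omega>) \<partial>M)"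
    if [measurable]: "\<Phi> \<in> borel_measurable (Pi\<^sub>M UNIV (\<lambda>_. N))" for \<Phi> :: "(int \<Rightarrow> 'b) \<Rightarrow> real" and h
  proof -
    have [measurable]: "(\<lambda>\<omega> t. Z (t + c) \<omega>) \<in> measurable M (Pi\<^sub>M UNIV (\<lambda>_. N))" for c
      by (rule measurable_PiM_single') (auto simp: PiE_def extensional_def measurable_space[OF Z])
    have m: "(\<lambda>\<omega>. \<Phi> (\<lambda>t. Z (t + c) \<omega>)) \<in> borel_measurable M" for c
      by measurable
    have "(\<integral>\<omega>. \<Phi> (\<lambda>t. Z (t + c) \<omega>) \<partial>M) = (\<integral>x. x \<partial>distr M borel (\<lambda>\<omega>. \<Phi> (\<lambda>t. Z (t + c) \<omega>)))" for c
      using m[of c] by (simp add: integral_distr)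
    from this[of h] this[of 0] strictly_stationary_functional[OF stat that, of h]
    show ?thesis by simp
  qed
  have mean: "(\<integral>\<omega>. f (Z s \<omega>) \<partial>M) = (\<integral>\<omega>. f (Z t \<omega>) \<partial>M)" for s t
    using shift[of "\<lambda>x. f (x t)" "s - t"] by simp
  define m where "m = (\<integral>\<omega>. f (Z 0 \<omega>) \<partial>M)"
  have m: "(\<integral>\<omega>. f (Z t \<omega>) \<partial>M) = m" for t
    using mean[of t 0] by (simp add: m_def)
  have "(\<integral>\<omega>. (f (Z (s + h) \<omega>) - m) * (f (Z s \<omega>) - m) \<partial>M)
      = (\<integral>\<omega>. (f (Z (t + h) \<omega>) - m) * (f (Z t \<omega>) - m) \<partial>M)" for s t h
    using shift[of "\<lambda>x. (f (x (t + h)) - m) * (f (x t) - m)" "s - t"] by (simp add: algebra_simps)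
  then show ?thesis
    unfolding weakly_stationary_def m using sq by auto
qed

section \<open>The beta negative binomial model\<close>

lemma subalgebra_past_sigma:
  assumes [measurable]: "\<And>s. y s \<in> measurable M (count_space UNIV)"
  shows "subalgebra M (past_sigma M y t)"
proof -
  have "{y s -` B \<inter> space M | s B. s \<le> t} \<subseteq> sets M"
    by auto
  then show ?thesis
    unfolding subalgebra_def past_sigma_def
    by (auto simp: space_measure_of_conv sets_measure_of_conv intro: sets.sigma_sets_subset[THEN subsetD])
qed

text \<open>A law determines its mean: the intensity is recovered from the conditional probabilities
  as the sum of \<open>k P(y\<^sub>t = k | past)\<close>, and each of these is measurable with respect to the past.\<close>

lemma bnb_intensity_AE_eq_past_measurable:
  assumes "prob_space M" "0 < r" "1 < \<alpha>" and model: "bnb_model M r \<alpha> g y lam"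
  obtains L where "L \<in> borel_measurable (past_sigma M y (t - 1))" "AE \<omega> in M. lam t \<omega> = L \<omega>"
proof -
  let ?F = "past_sigma M y (t - 1)"
  define L where "L \<omega> = (\<Sum>k. real k * real_cond_exp M ?F (indicator {\<omega> \<in> space M. y t \<omega> = k}) \<omega>)" for \<omega>
  have "AE \<omega> in M. \<forall>k. real_cond_exp M ?F (indicator {\<omega> \<in> space M. y t \<omega> = k}) \<omega>
      = bnb_mass (lam t \<omega>) r \<alpha> k"
    using model by (simp add: bnb_model_def AE_all_countable)
  moreover have "AE \<omega> in M. 0 < lam t \<omega>"
    using model by (simp add: bnb_model_def)
  ultimately have "AE \<omega> in M. lam t \<omega> = L \<omega>"
  proof eventually_elim
    case (elim \<omega>)
    then show ?case
      using bnb_mean_sums[of r \<alpha> "lam t \<omega>"] assms by (simp add: L_def sums_iff)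
  qed
  moreover have "L \<in> borel_measurable ?F"
    unfolding L_def by measurable
  ultimately show thesis using that by blast
qed

text \<open>The conditional law given the past counts averages \<open>y\<^sub>t\<close> out of a function of the pair
  \<open>(y\<^sub>t, \<lambda>\<^sub>t)\<close>, because \<open>\<lambda>\<^sub>t\<close> is almost surely a function of those counts.\<close>

lemma bnb_model_nn_integral:
  fixes \<phi> :: "nat \<Rightarrow> real \<Rightarrow> ennreal"
  assumes prob: "prob_space M" and "0 < r" "1 < \<alpha>" and model: "bnb_model M r \<alpha> g y lam"
    and [measurable]: "\<And>k. \<phi> k \<in> borel_measurable borel"
  shows "(\<integral>\<^sup>+\<omega>. \<phi> (y t \<omega>) (lam t \<omega>) \<partial>M)
    = (\<integral>\<^sup>+\<omega>. (\<Sum>k. \<phi> k (lam t \<omega>) * ennreal (bnb_mass (lam t \<omega>) r \<alpha> k)) \<partial>M)"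
proof -
  have y: "y s \<in> measurable M (count_space UNIV)" for s
    using model by (simp add: bnb_model_def)
  interpret prob_space M by fact
  interpret finite_measure_subalgebra M "past_sigma M y (t - 1)"
    by unfold_locales (rule subalgebra_past_sigma[OF y])
  obtain L where L: "L \<in> borel_measurable (past_sigma M y (t - 1))" and eq: "AE \<omega> in M. lam t \<omega> = L \<omega>"
    using bnb_intensity_AE_eq_past_measurable[OF prob assms(2,3) model] .
  have "(\<integral>\<^sup>+\<omega>. \<phi> (y t \<omega>) (lam t \<omega>) \<partial>M) = (\<integral>\<^sup>+\<omega>. \<phi> (y t \<omega>) (L \<omega>) \<partial>M)"
    by (rule nn_integral_cong_AE) (use eq in eventually_elim, simp)
  also have "\<dots> = (\<integral>\<^sup>+\<omega>. (\<Sum>k. \<phi> k (L \<omega>) * ennreal (bnb_mass (lam t \<omega>) r \<alpha> k)) \<partial>M)"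
    using model by (intro nn_integral_conditional_law y L) (auto simp: bnb_model_def)
  also have "\<dots> = (\<integral>\<^sup>+\<omega>. (\<Sum>k. \<phi> k (lam t \<omega>) * ennreal (bnb_mass (lam t \<omega>) r \<alpha> k)) \<partial>M)"
    by (rule nn_integral_cong_AE) (use eq in eventually_elim, simp)
  finally show ?thesis .
qed

text \<open>Jensen's inequality for the concave function \<open>min(\<cdot>, N)\<close>: truncation turns a bound on a
  conditional mean into a bound on the mean of the truncated variable.\<close>

lemma suminf_min_mixture_le:
  fixes a m :: "nat \<Rightarrow> real"
  assumes a: "\<And>k. 0 \<le> a k" and m: "\<And>k. 0 \<le> m k"
    and "m sums 1" and am: "(\<lambda>k. a k * m k) sums s" and N: "0 \<le> N"
  shows "(\<Sum>k. ennreal (min (a k) N) * ennreal (m k)) \<le> ennreal (min s N)"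
proof -
  have mN: "(\<lambda>k. N * m k) sums N"
    using sums_mult[OF assms(3), of N] by simp
  have summ: "summable (\<lambda>k. min (a k) N * m k)"
    by (rule summable_comparison_test'[OF sums_summable[OF mN], of 0])
      (use a m N in \<open>auto simp: abs_mult intro!: mult_right_mono\<close>)
  have "(\<Sum>k. min (a k) N * m k) \<le> min s N"
  proof (rule min.boundedI)
    show "(\<Sum>k. min (a k) N * m k) \<le> s"
      using m by (intro sums_le[OF _ summable_sums[OF summ] am] mult_right_mono) auto
    show "(\<Sum>k. min (a k) N * m k) \<le> N"
      using m by (intro sums_le[OF _ summable_sums[OF summ] mN] mult_right_mono) auto
  qed
  moreover have "(\<Sum>k. ennreal (min (a k) N) * ennreal (m k)) = ennreal (\<Sum>k. min (a k) N * m k)"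
    using a m N summ by (subst suminf_ennreal_eq[symmetric, OF _ summable_sums[OF summ]])
      (auto simp: ennreal_mult)
  ultimately show ?thesis
    by (simp add: ennreal_leI)
qed

text \<open>Averaging the squared affine bound on the next intensity over \<open>y\<^sub>t\<close> gives a drift inequality
  for the squared intensity, in which the leading coefficient is that of the moment condition.
  Truncation has to come before averaging, since the expectations may a priori be infinite.\<close>

lemma bnb_intensity_second_moment_bound:
  fixes g :: "nat \<times> real \<Rightarrow> real"
  assumes prob: "prob_space M" and r: "0 < r" and \<alpha>: "2 < \<alpha>"
    and d: "0 \<le> d" and c: "0 < c1" "0 < c2"
    and growth: "\<And>k l. 0 < l \<Longrightarrow> g (k, l) \<le> d + c1 * real k + c2 * l"
    and moment: "(r + 1) * (\<alpha> - 1) / (r * (\<alpha> - 2)) * c1\<^sup>2 + c2\<^sup>2 + 2 * c1 * c2 < 1"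
    and model: "bnb_model M r \<alpha> g y lam"
    and law: "distr M borel (\<lambda>\<omega>. (lam (t + 1) \<omega>)\<^sup>2) = distr M borel (\<lambda>\<omega>. (lam t \<omega>)\<^sup>2)"
  shows "(\<integral>\<^sup>+\<omega>. ennreal ((lam t \<omega>)\<^sup>2) \<partial>M) < \<infinity>"
proof -
  interpret prob_space M by fact
  have meas [measurable]: "lam s \<in> borel_measurable M" "y s \<in> measurable M (count_space UNIV)" for s
    using model by (auto simp: bnb_model_def)
  have pos: "AE \<omega> in M. 0 < lam s \<omega>" for s
    using model by (simp add: bnb_model_def)
  define \<rho>\<^sub>0 where "\<rho>\<^sub>0 = (r + 1) * (\<alpha> - 1) / (r * (\<alpha> - 2)) * c1\<^sup>2 + c2\<^sup>2 + 2 * c1 * c2"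
  define K where "K = c1\<^sup>2 * ((r + 1) / (\<alpha> - 2) + 1) + 2 * d * (c1 + c2)"
  \<comment> \<open>Half of the room below 1 is spent on absorbing the linear term \<open>K l\<close> by completing the
    square.\<close>
  define \<epsilon> where "\<epsilon> = (1 - \<rho>\<^sub>0) / 2"
  define C where "C = d\<^sup>2 + K\<^sup>2 / (4 * \<epsilon>)"
  have \<rho>\<^sub>0: "0 \<le> \<rho>\<^sub>0" "\<rho>\<^sub>0 < 1"
    using r \<alpha> c moment by (auto simp: \<rho>\<^sub>0_def)
  have \<epsilon>: "0 < \<epsilon>" using \<rho>\<^sub>0 by (simp add: \<epsilon>_def)
  have C: "0 \<le> C" using \<epsilon> by (simp add: C_def)
  have absorb: "\<rho>\<^sub>0 * l\<^sup>2 + K * l + d\<^sup>2 \<le> (\<rho>\<^sub>0 + \<epsilon>) * l\<^sup>2 + C" for l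
  proof -
    have "0 \<le> \<epsilon> * (l - K / (2 * \<epsilon>))\<^sup>2"
      using \<epsilon> by simp
    also have "\<dots> = \<epsilon> * l\<^sup>2 - K * l + K\<^sup>2 / (4 * \<epsilon>)"
      using \<epsilon> by (simp add: power2_eq_square field_simps)
    finally show ?thesis by (simp add: C_def algebra_simps)
  qed
  have "(\<integral>\<^sup>+\<omega>. ennreal ((lam t \<omega>)\<^sup>2) \<partial>M) \<le> ennreal (C / (1 - (\<rho>\<^sub>0 + \<epsilon>)))"
  proof (rule stationary_drift_bound[OF _ _ law])
    show "0 \<le> \<rho>\<^sub>0 + \<epsilon>" "\<rho>\<^sub>0 + \<epsilon> < 1"
      using \<rho>\<^sub>0 by (auto simp: \<epsilon>_def field_simps)
    fix N :: real
    assume N: "0 \<le> N"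
    let ?a = "\<lambda>k l. (d + c1 * real k + c2 * l)\<^sup>2"
    have step: "AE \<omega> in M. lam (t + 1) \<omega> = g (y t \<omega>, lam t \<omega>)"
      using model by (simp add: bnb_model_def)
    have "(\<integral>\<^sup>+\<omega>. ennreal (min ((lam (t + 1) \<omega>)\<^sup>2) N) \<partial>M)
        \<le> (\<integral>\<^sup>+\<omega>. ennreal (min (?a (y t \<omega>) (lam t \<omega>)) N) \<partial>M)"
    proof (rule nn_integral_mono_AE)
      from step pos[of t] pos[of "t + 1"]
      show "AE \<omega> in M. ennreal (min ((lam (t + 1) \<omega>)\<^sup>2) N) \<le> ennreal (min (?a (y t \<omega>) (lam t \<omega>)) N)"
      proof eventually_elim
        case (elim \<omega>)
        then have "(lam (t + 1) \<omega>)\<^sup>2 \<le> ?a (y t \<omega>) (lam t \<omega>)"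
          using growth[of "lam t \<omega>" "y t \<omega>"] by (intro power_mono) auto
        then show ?case by (intro ennreal_leI) auto
      qed
    qed
    also have "\<dots> = (\<integral>\<^sup>+\<omega>. (\<Sum>k. ennreal (min (?a k (lam t \<omega>)) N) * ennreal (bnb_mass (lam t \<omega>) r \<alpha> k)) \<partial>M)"
      using r \<alpha> by (intro bnb_model_nn_integral[OF prob _ _ model]) auto
    also have "\<dots> \<le> (\<integral>\<^sup>+\<omega>. ennreal (min ((\<rho>\<^sub>0 + \<epsilon>) * (lam t \<omega>)\<^sup>2 + C) N) \<partial>M)"
    proof (rule nn_integral_mono_AE)
      from pos[of t]
      show "AE \<omega> in M. (\<Sum>k. ennreal (min (?a k (lam t \<omega>)) N) * ennreal (bnb_mass (lam t \<omega>) r \<alpha> k))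
          \<le> ennreal (min ((\<rho>\<^sub>0 + \<epsilon>) * (lam t \<omega>)\<^sup>2 + C) N)"
      proof eventually_elim
        case (elim \<omega>)
        have "(\<Sum>k. ennreal (min (?a k (lam t \<omega>)) N) * ennreal (bnb_mass (lam t \<omega>) r \<alpha> k))
            \<le> ennreal (min (\<rho>\<^sub>0 * (lam t \<omega>)\<^sup>2 + K * lam t \<omega> + d\<^sup>2) N)"
          unfolding \<rho>\<^sub>0_def K_def using r \<alpha> elim N
          by (intro suminf_min_mixture_le bnb_affine_square_sums bnb_mass_sums bnb_mass_nonneg) auto
        also have "\<dots> \<le> ennreal (min ((\<rho>\<^sub>0 + \<epsilon>) * (lam t \<omega>)\<^sup>2 + C) N)"
          using absorb[of "lam t \<omega>"] by (intro ennreal_leI min.mono) auto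
        finally show ?case .
      qed
    qed
    finally show "(\<integral>\<^sup>+\<omega>. ennreal (min ((lam (t + 1) \<omega>)\<^sup>2) N) \<partial>M)
        \<le> (\<integral>\<^sup>+\<omega>. ennreal (min ((\<rho>\<^sub>0 + \<epsilon>) * (lam t \<omega>)\<^sup>2 + C) N) \<partial>M)" .
  qed (use C in auto)
  then show ?thesis
    by (rule le_less_trans) simp
qed

lemma bnb_count_square_integrable:
  assumes prob: "prob_space M" and r: "0 < r" and \<alpha>: "2 < \<alpha>"
    and model: "bnb_model M r \<alpha> g y lam"
    and fin: "(\<integral>\<^sup>+\<omega>. ennreal ((lam t \<omega>)\<^sup>2) \<partial>M) < \<infinity>"
  shows "integrable M (\<lambda>\<omega>. (real (y t \<omega>))\<^sup>2)"
proof -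
  interpret prob_space M by fact
  have meas [measurable]: "lam s \<in> borel_measurable M" "y s \<in> measurable M (count_space UNIV)" for s
    using model by (auto simp: bnb_model_def)
  define \<kappa> where "\<kappa> = (r + 1) * (\<alpha> - 1) / (r * (\<alpha> - 2))"
  define D where "D = (r + 1) / (\<alpha> - 2) + 1"
  have nonneg: "0 \<le> \<kappa>" "0 \<le> D"
    using r \<alpha> by (auto simp: \<kappa>_def D_def)
  have "(\<integral>\<^sup>+\<omega>. ennreal ((real (y t \<omega>))\<^sup>2) \<partial>M)
      = (\<integral>\<^sup>+\<omega>. (\<Sum>k. ennreal ((real k)\<^sup>2) * ennreal (bnb_mass (lam t \<omega>) r \<alpha> k)) \<partial>M)"
    using r \<alpha> by (intro bnb_model_nn_integral[OF prob _ _ model, of "\<lambda>k _. ennreal ((real k)\<^sup>2)"]) auto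
  also have "\<dots> \<le> (\<integral>\<^sup>+\<omega>. ennreal (\<kappa> + D) * ennreal ((lam t \<omega>)\<^sup>2) + ennreal D \<partial>M)"
  proof (rule nn_integral_mono_AE)
    have "AE \<omega> in M. 0 < lam t \<omega>"
      using model by (simp add: bnb_model_def)
    then show "AE \<omega> in M. (\<Sum>k. ennreal ((real k)\<^sup>2) * ennreal (bnb_mass (lam t \<omega>) r \<alpha> k))
        \<le> ennreal (\<kappa> + D) * ennreal ((lam t \<omega>)\<^sup>2) + ennreal D"
    proof eventually_elim
      case (elim \<omega>)
      let ?l = "lam t \<omega>"
      have mass: "0 \<le> bnb_mass ?l r \<alpha> k" for k
        using r \<alpha> elim by (intro bnb_mass_nonneg) auto
      have "(\<Sum>k. ennreal ((real k)\<^sup>2) * ennreal (bnb_mass ?l r \<alpha> k))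
          = (\<Sum>k. ennreal ((real k)\<^sup>2 * bnb_mass ?l r \<alpha> k))"
        using mass by (simp add: ennreal_mult)
      also have "\<dots> = ennreal (\<kappa> * ?l\<^sup>2 + D * ?l)"
        unfolding \<kappa>_def D_def using mass
        by (intro suminf_ennreal_eq bnb_second_moment_sums r \<alpha> elim) auto
      also have "\<dots> \<le> ennreal ((\<kappa> + D) * ?l\<^sup>2 + D)"
      proof (rule ennreal_leI)
        \<comment> \<open>Bounding the linear term by the square avoids a separate first moment.\<close>
        have "?l \<le> ?l\<^sup>2 + 1"
          using sum_power2_ge_zero[of "?l - 1" 0] elim by (simp add: power2_eq_square algebra_simps)
        then have "D * ?l \<le> D * (?l\<^sup>2 + 1)"
          using nonneg by (intro mult_left_mono)
        then show "\<kappa> * ?l\<^sup>2 + D * ?l \<le> (\<kappa> + D) * ?l\<^sup>2 + D"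
          by (simp add: algebra_simps)
      qed
      also have "\<dots> = ennreal (\<kappa> + D) * ennreal (?l\<^sup>2) + ennreal D"
        using nonneg by (simp add: ennreal_mult)
      finally show ?case .
    qed
  qed
  also have "\<dots> = ennreal (\<kappa> + D) * (\<integral>\<^sup>+\<omega>. ennreal ((lam t \<omega>)\<^sup>2) \<partial>M) + ennreal D"
    by (subst nn_integral_add) (auto simp: nn_integral_cmult emeasure_space_1)
  also have "\<dots> < \<infinity>"
    using fin by (simp add: ennreal_mult_less_top)
  finally show ?thesis
    by (intro integrableI_nonneg) auto
qed

section \<open>Finite second moment and weak stationarity\<close>

theorem theorem3p2:
  fixes M :: "'a measure"
    and r \<alpha> c1 c2 :: real
    and \<theta> :: "real ^ 'n"
    and g :: "real ^ 'n \<Rightarrow> nat \<times> real \<Rightarrow> real"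
    and u lam :: "int \<Rightarrow> 'a \<Rightarrow> real"
    and y :: "int \<Rightarrow> 'a \<Rightarrow> nat"
  assumes "0 < r" and "2 < \<alpha>"
    and g_range: "g \<theta> \<in> UNIV \<times> {0<..} \<rightarrow> {0<..}"
    and "0 < c1" and "0 < c2" and "c1 + c2 < 1"
    and contraction: "\<And>m m' l l'. 0 < l \<Longrightarrow> 0 < l' \<Longrightarrow>
      \<bar>g \<theta> (m, l) - g \<theta> (m', l')\<bar> \<le> c1 * \<bar>real m - real m'\<bar> + c2 * \<bar>l - l'\<bar>"
    and moment: "(r + 1) * (\<alpha> - 1) / (r * (\<alpha> - 2)) * c1\<^sup>2 + c2\<^sup>2 + 2 * c1 * c2 < 1"
    and "prob_space M"
    and innovations: "iid_uniform M u"
    and model: "bnb_model M r \<alpha> (g \<theta>) y lam"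
    and realization: "bnb_realization M r \<alpha> u y lam"
    and causal: "causal M u lam"
    and stationary:
      "strictly_stationary M (count_space UNIV \<Otimes>\<^sub>M borel) (\<lambda>t \<omega>. (y t \<omega>, lam t \<omega>))"
    and ergodic:
      "ergodic_process M (count_space UNIV \<Otimes>\<^sub>M borel) (\<lambda>t \<omega>. (y t \<omega>, lam t \<omega>))"
  shows "(\<forall>t. integrable M (\<lambda>\<omega>. (real (y t \<omega>))\<^sup>2)) \<and>
    weakly_stationary M (\<lambda>t \<omega>. real (y t \<omega>))"
proof -
  \<comment> \<open>Comparing \<open>(k, l)\<close> with the reference point \<open>(0, 1)\<close> in the contraction condition.\<close>
  define d where "d = g \<theta> (0, 1) + c2"
  have d: "0 \<le> d"
    using g_range \<open>0 < c2\<close> by (auto simp: d_def Pi_iff intro!: add_pos_pos less_imp_le)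
  have growth: "g \<theta> (k, l) \<le> d + c1 * real k + c2 * l" if "0 < l" for k l
  proof -
    have "g \<theta> (k, l) \<le> g \<theta> (0, 1) + c1 * real k + c2 * \<bar>l - 1\<bar>"
      using contraction[of l 1 k 0] that by simp
    also have "c2 * \<bar>l - 1\<bar> \<le> c2 * (l + 1)"
      using that \<open>0 < c2\<close> by (intro mult_left_mono) auto
    finally show ?thesis by (simp add: d_def algebra_simps)
  qed
  have "distr M borel (\<lambda>\<omega>. (lam (t + 1) \<omega>)\<^sup>2) = distr M borel (\<lambda>\<omega>. (lam t \<omega>)\<^sup>2)" for t
    using strictly_stationary_functional[OF stationary, of "\<lambda>x. (snd (x t))\<^sup>2" borel 1] by simp
  then have "(\<integral>\<^sup>+\<omega>. ennreal ((lam t \<omega>)\<^sup>2) \<partial>M) < \<infinity>" for t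
    using \<open>0 < r\<close> \<open>2 < \<alpha>\<close> \<open>0 < c1\<close> \<open>0 < c2\<close>
    by (intro bnb_intensity_second_moment_bound[OF \<open>prob_space M\<close> _ _ d _ _ growth moment model])
  then have sq: "integrable M (\<lambda>\<omega>. (real (y t \<omega>))\<^sup>2)" for t
    by (rule bnb_count_square_integrable[OF \<open>prob_space M\<close> \<open>0 < r\<close> \<open>2 < \<alpha>\<close> model])
  moreover have "weakly_stationary M (\<lambda>t \<omega>. real (y t \<omega>))"
    using strictly_stationary_imp_weakly_stationary[OF stationary, of "\<lambda>z. real (fst z)"] sq by simp
  ultimately show ?thesis by simp
qed

end
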